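(* Let $X_1,X_2,\ldots$ be independent and identically distributed, positive integer-valued random variables with $\mathbb{E}[X_1]=\mu\geq 1$, let $N$ be a non-negative integer-valued random variable independent of the $X_i$, and let $W=\sum_{i=1}^N X_i$. Let $p=\mathbb{P}(N=0)$, where $0<p<1$. Let $N^{(0)}$ be a random variable with $\mathcal{L}(N^{(0)})=\mathcal{L}(N\,|\,N>0)$, constructed on the same probability space as $N$ in such a way that $N^{(0)}\geq N$ almost surely, with the pair $(N,N^{(0)})$ independent of the $X_i$. Then $$d_{TV}(\mathcal{L}(W),\mathrm{Geom}(p))\leq(1-p)\,\mathbb{E}\left|\sum_{i=N+1}^{N^{(0)}}X_i-1\right|.$$ Moreover, if $$\frac{\mathbb{P}(N=j)}{\mathbb{P}(N>j)}\leq\frac{p}{1-p}$$ for all $j\in\mathbb{Z}^+$, then $$d_{TV}(\mathcal{L}(W),\mathrm{Geom}(p))\leq p(\mu\mathbb{E}[N]+1)-1.$$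
   Context: $\mathbb{Z}^+=\{0,1,2,\ldots\}$. $\mathcal{L}(X)$ denotes the law of $X$. $\mathrm{Geom}(p)$ is the distribution on $\mathbb{Z}^+$ with mass $p(1-p)^k$ at $k$. The total variation distance between laws of non-negative integer-valued random variables is $d_{TV}(\mathcal{L}(W),\mathcal{L}(Y))=\sup_{A\subseteq\mathbb{Z}^+}|\mathbb{P}(W\in A)-\mathbb{P}(Y\in A)|$. An empty sum is zero. Since $N^{(0)}$ is stochastically larger than $N$, a coupling with $N^{(0)}\geq N$ almost surely exists. *)

theory Defs
  imports "HOL-Probability.Probability"
begin

definition law :: "'a measure \<Rightarrow> ('a \<Rightarrow> nat) \<Rightarrow> nat measure" where
  "law M X = distr M (count_space UNIV) X"

definition tv_dist :: "nat measure \<Rightarrow> nat measure \<Rightarrow> real" where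
  "tv_dist P Q = (SUP A. \<bar>measure P A - measure Q A\<bar>)"

text \<open>
  The library's \<^verbatim>\<open>indep_var\<close> requires both random variables to take values in the same type.
  This is the same notion for values in two different types.
\<close>

definition (in prob_space) indep_rv ::
  "'b measure \<Rightarrow> ('a \<Rightarrow> 'b) \<Rightarrow> 'c measure \<Rightarrow> ('a \<Rightarrow> 'c) \<Rightarrow> bool" where
  "indep_rv A X B Y \<longleftrightarrow> random_variable A X \<and> random_variable B Y \<and>
     indep_set {X -` S \<inter> space M | S. S \<in> sets A} {Y -` S \<inter> space M | S. S \<in> sets B}"

lemma (in prob_space) indep_rv_iff_indep_var: "indep_rv A X B Y \<longleftrightarrow> indep_var A X B Y"
proof -
  have *: "(\<lambda>b. {case_bool X Y b -` S \<inter> space M | S. S \<in> sets (case_bool A B b)}) =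
    case_bool {X -` S \<inter> space M | S. S \<in> sets A} {Y -` S \<inter> space M | S. S \<in> sets B}"
    by (rule ext) (simp split: bool.split)
  show ?thesis
    unfolding indep_rv_def indep_var_def indep_vars_def2 indep_set_def *
    by (auto simp: UNIV_bool)
qed

end

theory Submission
  imports Defs
begin

text \<open>
  Stein's method. With \<open>q = 1 - p\<close> and \<open>A\<close> a set of naturals, the recursion
  \<open>q f (k + 1) - f k = 1\<^sub>A k - Geom(p) A\<close>, \<open>f 0 = 0\<close>, has a bounded 1-Lipschitz solution \<open>f\<close>, so
  \<open>P (W \<in> A) - Geom(p) A = q E f (W + 1) - E f W\<close>. Since \<open>f 0 = 0\<close>, conditioning on \<open>N > 0\<close> gives
  \<open>E f W = q E f W0\<close>, where \<open>W0\<close> sums the first \<open>N0\<close> terms; the Lipschitz bound for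
  \<open>f (W + 1) - f W0\<close> yields the first inequality.

  Under the hazard condition no coupling with \<open>N0 \<ge> N + 1\<close> needs to be built. The function
  \<open>g n = E f (X 1 + \<dots> + X n)\<close> is \<open>\<mu>\<close>-Lipschitz, so \<open>\<phi> n = \<mu> n \<plusminus> g n\<close> is monotone, and the condition,
  which says \<open>q P (N \<ge> k) \<le> P (N > k)\<close>, gives \<open>q E \<phi> (N + 1) \<le> E \<phi> N\<close> by integrating tails.
  Replacing \<open>f (\<dots> + 1)\<close> by \<open>f (\<dots> + X (n + 1))\<close> costs at most \<open>\<mu> - 1\<close> in expectation.
\<close>

text \<open>Everything is read off from the discounted sum \<open>s k\<close> of the indicator of
  \<open>A\<close> from \<open>k\<close> onwards: it lies between 0 and \<open>1 / p\<close>, and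
  splitting off its first term gives the recursion.\<close>

lemma geometric_stein_solution:
  fixes p :: real and A :: "nat set"
  assumes p: "0 < p" "p < 1"
  obtains f :: "nat \<Rightarrow> real" where "f 0 = 0"
    and "\<And>k. (1 - p) * f (Suc k) - f k = indicator A k - measure_pmf.prob (geometric_pmf p) A"
    and "\<And>j k. \<bar>f j - f k\<bar> \<le> \<bar>real j - real k\<bar>"
    and "\<And>k. \<bar>f k\<bar> \<le> 1 / p"
proof -
  define q where "q = 1 - p"
  have q: "0 < q" "q < 1" "p = 1 - q" using p by (auto simp: q_def)
  \<comment> \<open>\<open>f k = s 0 - s k\<close> is the only bounded solution of the recursion.\<close>
  define s where "s k = (\<Sum>i. q ^ i * indicator A (k + i))" for k
  have geo: "(\<lambda>i. q ^ i) sums (1 / p)"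
    using geometric_sums[of q] q by auto
  have summ: "summable (\<lambda>i. q ^ i * indicator A (k + i) :: real)" for k
    by (rule summable_comparison_test'[OF sums_summable[OF geo], of 0])
      (use q in \<open>auto simp: indicator_def\<close>)
  have rec: "s k = indicator A k + q * s (Suc k)" for k
    unfolding s_def suminf_split_head[OF summ[of k], simplified, THEN eq_diff_eq[THEN iffD1], symmetric]
    by (subst suminf_mult[OF summ, symmetric]) (simp add: mult_ac)
  have s0: "0 \<le> s k" for k
    unfolding s_def by (intro suminf_nonneg summ) (use q in auto)
  have s1: "s k \<le> 1 / p" for k
    unfolding s_def sums_unique[OF geo]
    by (intro suminf_le summ sums_summable[OF geo]) (use q in \<open>auto simp: indicator_def\<close>)
  \<comment> \<open>Splitting \<open>A\<close> into points gives Geom(p) A = \<open>p * s 0\<close>,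
    exactly the constant left over when \<open>s 0 - s k\<close> is inserted into the
    recursion.\<close>
  have "(\<lambda>i. measure_pmf.prob (geometric_pmf p) (A \<inter> {i})) sums
      measure_pmf.prob (geometric_pmf p) (\<Union>i. A \<inter> {i})"
    by (intro measure_pmf.finite_measure_UNION) (auto simp: disjoint_family_on_def)
  moreover have "measure_pmf.prob (geometric_pmf p) (A \<inter> {i}) = p * (q ^ i * indicator A (0 + i))" for i
    using p by (cases "i \<in> A") (auto simp: measure_pmf_single q_def)
  moreover have "(\<Union>i. A \<inter> {i}) = A" by auto
  ultimately have "(\<lambda>i. p * (q ^ i * indicator A (0 + i))) sums measure_pmf.prob (geometric_pmf p) A"
    by simp
  then have geomA: "measure_pmf.prob (geometric_pmf p) A = p * s 0"
    unfolding s_def by (simp add: sums_iff suminf_mult[OF summ[of 0, simplified]])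
  define f where "f k = s 0 - s k" for k
  \<comment> \<open>The increment is a difference of two numbers in [0, 1], so the Lipschitz
    constant is 1 whatever \<open>p\<close> is.\<close>
  have step: "\<bar>f (Suc k) - f k\<bar> \<le> 1" for k
  proof -
    have "f (Suc k) - f k = indicator A k - p * s (Suc k)"
      unfolding f_def rec[of k] by (simp add: q(3) algebra_simps)
    moreover have "0 \<le> p * s (Suc k)" "p * s (Suc k) \<le> 1"
      using s0[of "Suc k"] s1[of "Suc k"] p by (auto simp: field_simps)
    ultimately show ?thesis by (auto simp: indicator_def)
  qed
  have lip: "\<bar>f (k + m) - f k\<bar> \<le> real m" for k m
  proof (induction m)
    case (Suc m)
    then show ?case using step[of "k + m"] by simp
  qed simp
  show thesis
  proof
    show "f 0 = 0" by (simp add: f_def)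
    show "(1 - p) * f (Suc k) - f k = indicator A k - measure_pmf.prob (geometric_pmf p) A" for k
      unfolding geomA f_def rec[of k] by (simp add: q(3) algebra_simps)
    show "\<bar>f j - f k\<bar> \<le> \<bar>real j - real k\<bar>" for j k
    proof (cases "j \<le> k")
      case True
      then show ?thesis using lip[of j "k - j"] by simp
    next
      case False
      then show ?thesis using lip[of k "j - k"] by simp
    qed
    show "\<bar>f k\<bar> \<le> 1 / p" for k
      using s0[of k] s1[of k] s0[of 0] s1[of 0] by (auto simp: f_def)
  qed
qed

context prob_space
begin

text \<open>Preimages under the composed maps are already preimages under \<open>X\<close> and
  \<open>Y\<close>, so the independent families only get smaller. This extracts the independence of
  \<open>N0\<close> from that of the pair, and yields the real-valued factors in product
  expectations.\<close>

lemma indep_rv_compose: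
  assumes indep: "indep_rv A X B Y"
    and u [measurable]: "u \<in> A \<rightarrow>\<^sub>M C" and v [measurable]: "v \<in> B \<rightarrow>\<^sub>M D"
  shows "indep_rv C (\<lambda>\<omega>. u (X \<omega>)) D (\<lambda>\<omega>. v (Y \<omega>))"
proof -
  have X [measurable]: "X \<in> M \<rightarrow>\<^sub>M A" and Y [measurable]: "Y \<in> M \<rightarrow>\<^sub>M B"
    using indep by (auto simp: indep_rv_def)
  have pre: "\<exists>T. (\<lambda>\<omega>. h (Z \<omega>)) -` S \<inter> space M = Z -` T \<inter> space M \<and> T \<in> sets E"
    if "S \<in> sets F" "h \<in> E \<rightarrow>\<^sub>M F" "Z \<in> M \<rightarrow>\<^sub>M E" for h Z S E F
    using that by (intro exI[of _ "h -` S \<inter> space E"]) (auto dest: measurable_space)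
  have "indep_set {(\<lambda>\<omega>. u (X \<omega>)) -` S \<inter> space M |S. S \<in> sets C} {(\<lambda>\<omega>. v (Y \<omega>)) -` S \<inter> space M |S. S \<in> sets D}"
    unfolding indep_set_def
    by (rule indep_sets_mono_sets[OF indep[unfolded indep_rv_def indep_set_def, THEN conjunct2, THEN conjunct2]])
      (auto split: bool.split intro!: pre[OF _ u X] pre[OF _ v Y])
  then show ?thesis
    unfolding indep_rv_def using measurable_compose[OF X u] measurable_compose[OF Y v] by blast
qed

lemma sums_prob_values:
  fixes T :: "'a \<Rightarrow> nat"
  assumes [measurable]: "T \<in> M \<rightarrow>\<^sub>M count_space UNIV"
  shows "(\<lambda>n. \<P>(\<omega> in M. T \<omega> = n)) sums 1"
proof -
  have "(\<lambda>n. prob {\<omega>\<in>space M. T \<omega> = n}) sums prob (\<Union>n. {\<omega>\<in>space M. T \<omega> = n})"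
    by (intro finite_measure_UNION) (auto simp: disjoint_family_on_def)
  moreover have "(\<Union>n. {\<omega>\<in>space M. T \<omega> = n}) = space M" by auto
  ultimately show ?thesis by (simp add: prob_space)
qed

text \<open>Split by the value of \<open>T\<close>: independence turns the contribution of
  \<open>T = n\<close> into a product, and the uniform bound \<open>C\<close> gives absolute
  convergence. This takes the place of conditional expectation given \<open>T\<close>.\<close>

lemma expectation_random_index:
  fixes T :: "'a \<Rightarrow> nat" and v :: "nat \<Rightarrow> 'b \<Rightarrow> real"
  assumes indep: "indep_rv (count_space UNIV) T B Y"
    and v [measurable]: "\<And>n. v n \<in> borel_measurable B"
    and bound: "\<And>n y. \<bar>v n y\<bar> \<le> C"
  shows "(\<lambda>n. \<P>(\<omega> in M. T \<omega> = n) * expectation (\<lambda>\<omega>. v n (Y \<omega>))) sums expectation (\<lambda>\<omega>. v (T \<omega>) (Y \<omega>))"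
proof -
  have T [measurable]: "T \<in> M \<rightarrow>\<^sub>M count_space UNIV" and Y [measurable]: "Y \<in> M \<rightarrow>\<^sub>M B"
    using indep by (auto simp: indep_rv_def)
  define F where "F n \<omega> = indicator {n} (T \<omega>) * v n (Y \<omega>)" for n \<omega>
  have single: "F n \<omega> = (if n = T \<omega> then v (T \<omega>) (Y \<omega>) else 0)" for n \<omega>
    by (auto simp: F_def)
  have vi: "integrable M (\<lambda>\<omega>. v n (Y \<omega>))" for n
    by (rule integrable_const_bound[of _ C]) (use bound in auto)
  have EI: "expectation (\<lambda>\<omega>. indicator {n} (T \<omega>)) = \<P>(\<omega> in M. T \<omega> = n)" for n
  proof -
    have "(\<lambda>\<omega>. indicator {n} (T \<omega>) :: real) = indicator (T -` {n})" by (auto simp: indicator_def)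
    moreover have "T -` {n} \<inter> space M = {\<omega> \<in> space M. T \<omega> = n}" by auto
    ultimately show ?thesis by simp
  qed
  have II: "integrable M (\<lambda>\<omega>. indicator {n} (T \<omega>) :: real)" for n
    by (rule integrable_const_bound[of _ 1]) (auto simp: indicator_def)
  \<comment> \<open>After composition both variables are real-valued, so they share a type and the
    product formula for expectations applies.\<close>
  have iv: "indep_var borel (\<lambda>\<omega>. indicator {n} (T \<omega>) :: real) borel (\<lambda>\<omega>. v n (Y \<omega>))" for n
    unfolding indep_rv_iff_indep_var[symmetric] by (rule indep_rv_compose[OF indep]) auto
  have EF: "expectation (F n) = \<P>(\<omega> in M. T \<omega> = n) * expectation (\<lambda>\<omega>. v n (Y \<omega>))" for n
    unfolding F_def EI[symmetric] by (rule indep_var_lebesgue_integral[OF iv II vi])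
  have IF: "integrable M (F n)" for n
    unfolding F_def by (rule indep_var_integrable[OF iv II vi])
  have "(\<lambda>n. expectation (F n)) sums expectation (\<lambda>\<omega>. \<Sum>n. F n \<omega>)"
  proof (rule sums_integral[OF IF])
    show "AE \<omega> in M. summable (\<lambda>n. norm (F n \<omega>))"
      by (intro AE_I2 summable_finite[of "{T _}"]) (auto simp: single)
    \<comment> \<open>The dominating series is \<open>C\<close> times the point masses of
      \<open>T\<close>.\<close>
    show "summable (\<lambda>n. expectation (\<lambda>\<omega>. norm (F n \<omega>)))"
    proof (rule summable_comparison_test'[of "\<lambda>n. C * \<P>(\<omega> in M. T \<omega> = n)" 0])
      show "summable (\<lambda>n. C * \<P>(\<omega> in M. T \<omega> = n))"
        using sums_prob_values[OF T] by (intro summable_mult) (rule sums_summable)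
      show "norm (expectation (\<lambda>\<omega>. norm (F n \<omega>))) \<le> C * \<P>(\<omega> in M. T \<omega> = n)" for n
      proof -
        have "expectation (\<lambda>\<omega>. norm (F n \<omega>)) \<le> expectation (\<lambda>\<omega>. C * indicator {n} (T \<omega>))"
          by (rule integral_mono[OF integrable_norm[OF IF] integrable_mult_right[OF II]])
            (auto simp: F_def bound indicator_def)
        then show ?thesis by (simp add: EI)
      qed
    qed
  qed
  moreover have "(\<Sum>n. F n \<omega>) = v (T \<omega>) (Y \<omega>)" for \<omega>
    using suminf_finite[of "{T \<omega>}" "\<lambda>n. F n \<omega>"] by (auto simp: single)
  ultimately show ?thesis by (simp add: EF)
qed

text \<open>Discrete layer-cake formula: \<open>d k\<close> is counted exactly on the event
  \<open>k < T\<close>, and monotone convergence exchanges sum and integral.\<close>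

lemma nn_integral_sum_below:
  fixes T :: "'a \<Rightarrow> nat" and d :: "nat \<Rightarrow> ennreal"
  assumes [measurable]: "T \<in> M \<rightarrow>\<^sub>M count_space UNIV"
  shows "(\<integral>\<^sup>+\<omega>. (\<Sum>k<T \<omega>. d k) \<partial>M) = (\<Sum>k. d k * emeasure M {\<omega>\<in>space M. k < T \<omega>})"
proof -
  have "(\<Sum>k<T \<omega>. d k) = (\<Sum>k. d k * indicator {\<omega>\<in>space M. k < T \<omega>} \<omega>)" if "\<omega> \<in> space M" for \<omega>
    using that by (subst suminf_finite[of "{..<T \<omega>}"]) auto
  then have "(\<integral>\<^sup>+\<omega>. (\<Sum>k<T \<omega>. d k) \<partial>M) = (\<integral>\<^sup>+\<omega>. (\<Sum>k. d k * indicator {\<omega>\<in>space M. k < T \<omega>} \<omega>) \<partial>M)"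
    by (intro nn_integral_cong) auto
  also have "\<dots> = (\<Sum>k. \<integral>\<^sup>+\<omega>. d k * indicator {\<omega>\<in>space M. k < T \<omega>} \<omega> \<partial>M)"
    by (intro nn_integral_suminf) auto
  finally show ?thesis by (simp add: nn_integral_cmult_indicator)
qed

text \<open>Summation by parts: E \<phi>(T + 1) and E \<phi>(T) are series in the same nonnegative
  increments of \<phi>, weighted by P(T \<ge> k) and P(T > k). The hypothesis compares the weights
  term by term.\<close>

lemma expectation_Suc_le_of_tail_dominance:
  fixes T :: "'a \<Rightarrow> nat" and \<phi> :: "nat \<Rightarrow> real"
  assumes T [measurable]: "T \<in> M \<rightarrow>\<^sub>M count_space UNIV"
    and \<phi>: "mono \<phi>" "\<phi> 0 = 0"
    and int: "integrable M (\<lambda>\<omega>. \<phi> (T \<omega>))" "integrable M (\<lambda>\<omega>. \<phi> (Suc (T \<omega>)))"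
    and c: "0 \<le> c"
    and dom: "\<And>k. c * \<P>(\<omega> in M. k \<le> T \<omega>) \<le> \<P>(\<omega> in M. k < T \<omega>)"
  shows "c * expectation (\<lambda>\<omega>. \<phi> (Suc (T \<omega>))) \<le> expectation (\<lambda>\<omega>. \<phi> (T \<omega>))"
proof -
  \<comment> \<open>Monotonicity keeps the increments nonnegative, so \<open>ennreal\<close>
    truncates nothing; \<open>\<phi> 0 = 0\<close> makes them telescope to \<open>\<phi> n\<close>
    itself.\<close>
  define d where "d k = ennreal (\<phi> (Suc k) - \<phi> k)" for k
  have dsum: "(\<Sum>k<n. d k) = ennreal (\<phi> n)" for n
    unfolding d_def using \<phi> by (subst sum_ennreal) (auto simp: sum_lessThan_telescope mono_def)
  have pos: "0 \<le> \<phi> n" for n using \<phi> by (metis monoD zero_le)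
  have "ennreal c * (\<integral>\<^sup>+\<omega>. ennreal (\<phi> (Suc (T \<omega>))) \<partial>M)
      = ennreal c * (\<Sum>k. d k * emeasure M {\<omega>\<in>space M. k < Suc (T \<omega>)})"
    unfolding dsum[symmetric] by (subst nn_integral_sum_below) auto
  also have "\<dots> = (\<Sum>k. ennreal c * (d k * emeasure M {\<omega>\<in>space M. k < Suc (T \<omega>)}))"
    by simp
  also have "\<dots> \<le> (\<Sum>k. d k * emeasure M {\<omega>\<in>space M. k < T \<omega>})"
  proof (intro suminf_le summableI)
    fix k
    \<comment> \<open>\<open>k < Suc (T \<omega>)\<close> is \<open>k \<le> T \<omega>\<close>; this
      shift by one produces the left side of \<open>dom\<close>.\<close>
    have "ennreal c * emeasure M {\<omega>\<in>space M. k < Suc (T \<omega>)} \<le> emeasure M {\<omega>\<in>space M. k < T \<omega>}"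
      using dom[of k] c by (simp add: emeasure_eq_measure ennreal_mult[symmetric] less_Suc_eq_le)
    then show "ennreal c * (d k * emeasure M {\<omega>\<in>space M. k < Suc (T \<omega>)}) \<le> d k * emeasure M {\<omega>\<in>space M. k < T \<omega>}"
      by (subst mult.left_commute) (rule mult_left_mono, auto)
  qed
  also have "\<dots> = (\<integral>\<^sup>+\<omega>. ennreal (\<phi> (T \<omega>)) \<partial>M)"
    unfolding dsum[symmetric] by (subst nn_integral_sum_below) auto
  finally show ?thesis
    using pos int c by (simp add: nn_integral_eq_integral ennreal_mult[symmetric] integral_nonneg_AE)
qed

end

theorem theorem3p1:
  fixes M :: "'a measure" and X :: "nat \<Rightarrow> 'a \<Rightarrow> nat" and N N0 :: "'a \<Rightarrow> nat"
    and W :: "'a \<Rightarrow> nat" and \<mu> p :: real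
  assumes M: "prob_space M"
    and X_indep: "prob_space.indep_vars M (\<lambda>_. count_space UNIV) X {1..}"
    and X_ident: "\<forall>i\<ge>1. law M (X i) = law M (X 1)"
    and X_pos: "\<forall>i\<ge>1. AE \<omega> in M. X i \<omega> > 0"
    and X_integrable: "integrable M (\<lambda>\<omega>. real (X 1 \<omega>))"
    and X_mean: "(\<integral>\<omega>. real (X 1 \<omega>) \<partial>M) = \<mu>" and mu: "\<mu> \<ge> 1"
    and N_indep_X: "prob_space.indep_rv M (count_space UNIV) N
          (\<Pi>\<^sub>M i\<in>{1..}. count_space UNIV) (\<lambda>\<omega>. \<lambda>i\<in>{1..}. X i \<omega>)"
    and W: "W = (\<lambda>\<omega>. \<Sum>i=1..N \<omega>. X i \<omega>)"
    and p: "p = \<P>(\<omega> in M. N \<omega> = 0)" "0 < p" "p < 1"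
    and N0_law: "law M N0 = law (uniform_measure M {\<omega>\<in>space M. N \<omega> > 0}) N"
    and N0_ge: "AE \<omega> in M. N0 \<omega> \<ge> N \<omega>"
    and pair_indep_X: "prob_space.indep_rv M (count_space UNIV) (\<lambda>\<omega>. (N \<omega>, N0 \<omega>))
          (\<Pi>\<^sub>M i\<in>{1..}. count_space UNIV) (\<lambda>\<omega>. \<lambda>i\<in>{1..}. X i \<omega>)"
  shows "ennreal (tv_dist (law M W) (measure_pmf (geometric_pmf p)))
           \<le> ennreal (1 - p) * (\<integral>\<^sup>+ \<omega>. ennreal \<bar>real (\<Sum>i=N \<omega> + 1..N0 \<omega>. X i \<omega>) - 1\<bar> \<partial>M)
       \<and> ((\<forall>j. ennreal \<P>(\<omega> in M. N \<omega> = j) / ennreal \<P>(\<omega> in M. N \<omega> > j) \<le> ennreal (p / (1 - p)))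
           \<longrightarrow> ereal (tv_dist (law M W) (measure_pmf (geometric_pmf p)))
                 \<le> ereal p * (ereal \<mu> * enn2ereal (\<integral>\<^sup>+ \<omega>. of_nat (N \<omega>) \<partial>M) + 1) - 1)"
proof -

  \<comment> \<open>Random sums as functions of an index and an independent sequence\<close>
  interpret prob_space M by (rule M)
  define q where "q = 1 - p"
  have q: "0 < q" "q < 1" "p = 1 - q" using p by (auto simp: q_def)
  define Y where "Y = (\<lambda>\<omega>. \<lambda>i\<in>{1..}. X i \<omega>)"
  define B where "B = (\<Pi>\<^sub>M i\<in>{1::nat..}. count_space (UNIV :: nat set))"
  \<comment> \<open>\<open>S\<close> acts on fixed sequences, so a random sum is \<open>S\<close>
    with a random index evaluated at \<open>Y\<close>, the form needed to split by the value of the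
    index.\<close>
  define S where "S n y = (\<Sum>i=1..n. y i)" for n and y :: "nat \<Rightarrow> nat"
  note indep_N = N_indep_X[folded Y_def B_def]
  have indep_N0: "indep_rv (count_space UNIV) N0 B Y"
    using indep_rv_compose[OF pair_indep_X[folded Y_def B_def], of snd "count_space UNIV" "\<lambda>y. y" B] by simp
  have N_meas [measurable]: "N \<in> M \<rightarrow>\<^sub>M count_space UNIV"
    and Y_meas [measurable]: "Y \<in> M \<rightarrow>\<^sub>M B"
    using indep_N by (auto simp: indep_rv_def)
  have N0_meas [measurable]: "N0 \<in> M \<rightarrow>\<^sub>M count_space UNIV"
    using indep_N0 by (auto simp: indep_rv_def)
  have X_meas: "X i \<in> M \<rightarrow>\<^sub>M count_space UNIV" if "1 \<le> i" for i
    using X_indep that by (auto simp: indep_vars_def)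
  have S_meas [measurable]: "S n \<in> B \<rightarrow>\<^sub>M count_space UNIV" for n
  proof (induction n)
    case (Suc n)
    have component: "(\<lambda>y. y (Suc n)) \<in> B \<rightarrow>\<^sub>M count_space UNIV"
      unfolding B_def by (rule measurable_component_singleton) simp
    have "(\<lambda>y. S n y + y (Suc n)) \<in> B \<rightarrow>\<^sub>M count_space UNIV"
      by (rule measurable_compose_countable[OF _ Suc, where f="\<lambda>k y. k + y (Suc n)"])
        (rule measurable_compose[OF component], simp)
    moreover have "S (Suc n) = (\<lambda>y. S n y + y (Suc n))" by (rule ext) (simp add: S_def)
    ultimately show ?case by simp
  qed (simp add: S_def)
  have SY: "S n (Y \<omega>) = (\<Sum>i=1..n. X i \<omega>)" for n \<omega>
    by (simp add: S_def Y_def)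
  have S_Suc: "S (Suc n) (Y \<omega>) = S n (Y \<omega>) + X (Suc n) \<omega>" for n \<omega>
    by (simp add: SY)
  \<comment> \<open>The index takes countably many values, so measurability can be checked for each
    fixed \<open>n\<close>.\<close>
  have random_sum_meas: "(\<lambda>\<omega>. S (T \<omega>) (Y \<omega>)) \<in> M \<rightarrow>\<^sub>M count_space UNIV"
    if [measurable]: "T \<in> M \<rightarrow>\<^sub>M count_space UNIV" for T
    by (rule measurable_compose_countable[where g=T and f="\<lambda>n \<omega>. S n (Y \<omega>)"]) measurable
  have W_eq: "W = (\<lambda>\<omega>. S (N \<omega>) (Y \<omega>))" by (simp add: W SY)
  define W0 where "W0 = (\<lambda>\<omega>. S (N0 \<omega>) (Y \<omega>))"
  have W_meas [measurable]: "W \<in> M \<rightarrow>\<^sub>M count_space UNIV"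
    unfolding W_eq by (rule random_sum_meas) simp
  have W0_meas [measurable]: "W0 \<in> M \<rightarrow>\<^sub>M count_space UNIV"
    unfolding W0_def by (rule random_sum_meas) simp

  \<comment> \<open>Total variation and the Stein identity for \<open>W\<close>\<close>
  have tv_le: "tv_dist (law M W) (measure_pmf (geometric_pmf p)) \<le> r"
    if "\<And>A. \<bar>measure (law M W) A - measure_pmf.prob (geometric_pmf p) A\<bar> \<le> r" for r
    unfolding tv_dist_def by (rule cSUP_least) (use that in auto)

  have stein: "\<exists>f :: nat \<Rightarrow> real. f 0 = 0 \<and> (\<forall>j k. \<bar>f j - f k\<bar> \<le> \<bar>real j - real k\<bar>) \<and> (\<forall>k. \<bar>f k\<bar> \<le> 1 / p) \<and>
      measure (law M W) A - measure_pmf.prob (geometric_pmf p) A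
        = q * expectation (\<lambda>\<omega>. f (Suc (W \<omega>))) - expectation (\<lambda>\<omega>. f (W \<omega>))" for A
  proof -
    obtain f :: "nat \<Rightarrow> real" where f: "f 0 = 0" "\<And>j k. \<bar>f j - f k\<bar> \<le> \<bar>real j - real k\<bar>" "\<And>k. \<bar>f k\<bar> \<le> 1 / p"
      and eq: "\<And>k. (1 - p) * f (Suc k) - f k = indicator A k - measure_pmf.prob (geometric_pmf p) A"
      using geometric_stein_solution[OF p(2,3)] by metis
    \<comment> \<open>Boundedness of \<open>f\<close> gives integrability even when \<open>W\<close>
      has infinite mean.\<close>
    have int: "integrable M (\<lambda>\<omega>. f (h (W \<omega>)))" for h :: "nat \<Rightarrow> nat"
      by (rule integrable_const_bound[of _ "1 / p"]) (use f in auto)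
    have "measure (law M W) A = prob (W -` A \<inter> space M)"
      by (simp add: law_def measure_distr)
    also have "\<dots> = expectation (indicator (W -` A))"
      by simp
    also have "indicator (W -` A) = (\<lambda>\<omega>. indicator A (W \<omega>) :: real)"
      by (auto simp: indicator_def)
    finally have "measure (law M W) A - measure_pmf.prob (geometric_pmf p) A
        = expectation (\<lambda>\<omega>. indicator A (W \<omega>)) - measure_pmf.prob (geometric_pmf p) A" by simp
    also have "\<dots> = expectation (\<lambda>\<omega>. indicator A (W \<omega>) - measure_pmf.prob (geometric_pmf p) A)"
      by (subst Bochner_Integration.integral_diff)
        (auto simp: prob_space indicator_def intro!: integrable_const_bound[of _ 1])
    also have "\<dots> = q * expectation (\<lambda>\<omega>. f (Suc (W \<omega>))) - expectation (\<lambda>\<omega>. f (W \<omega>))"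
      unfolding eq[symmetric] q_def[symmetric] using int[of Suc] int[of "\<lambda>k. k"] by simp
    finally show ?thesis using f by metis
  qed

  \<comment> \<open>Point masses of \<open>N0\<close>\<close>
  have N0_prob: "q * \<P>(\<omega> in M. N0 \<omega> = n) = (if n = 0 then 0 else \<P>(\<omega> in M. N \<omega> = n))" for n
  proof -
    let ?E = "{\<omega>\<in>space M. N \<omega> > 0}"
    have "prob ?E = q"
      using prob_neg[of "\<lambda>\<omega>. N \<omega> = 0"] p(1) q_def by simp
    have E0: "emeasure M ?E \<noteq> 0" "emeasure M ?E \<noteq> \<infinity>"
      using \<open>prob ?E = q\<close> q by (auto simp: emeasure_eq_measure)
    have "\<P>(\<omega> in M. N0 \<omega> = n) = measure (law M N0) {n}"
      by (simp add: law_def measure_distr vimage_def Int_def conj_commute)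
    also have "\<dots> = measure (uniform_measure M ?E) {\<omega>\<in>space M. N \<omega> = n}"
      unfolding N0_law by (simp add: law_def measure_distr vimage_def Int_def conj_commute)
    also have "\<dots> = prob (?E \<inter> {\<omega>\<in>space M. N \<omega> = n}) / q"
      using E0 \<open>prob ?E = q\<close> by (subst measure_uniform_measure) auto
    also have "?E \<inter> {\<omega>\<in>space M. N \<omega> = n} = (if n = 0 then {} else {\<omega>\<in>space M. N \<omega> = n})"
      by auto
    finally show ?thesis using q by simp
  qed

  \<comment> \<open>The first inequality\<close>
  have part1: "ennreal \<bar>measure (law M W) A - measure_pmf.prob (geometric_pmf p) A\<bar>
      \<le> ennreal q * (\<integral>\<^sup>+ \<omega>. ennreal \<bar>real (\<Sum>i=N \<omega> + 1..N0 \<omega>. X i \<omega>) - 1\<bar> \<partial>M)" for A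
  proof -
    obtain f :: "nat \<Rightarrow> real" where f0: "f 0 = 0" and lip: "\<And>j k. \<bar>f j - f k\<bar> \<le> \<bar>real j - real k\<bar>"
      and bd: "\<And>k. \<bar>f k\<bar> \<le> 1 / p"
      and eq: "measure (law M W) A - measure_pmf.prob (geometric_pmf p) A
        = q * expectation (\<lambda>\<omega>. f (Suc (W \<omega>))) - expectation (\<lambda>\<omega>. f (W \<omega>))"
      using stein[of A] by metis
    have *: "(\<lambda>n. \<P>(\<omega> in M. T \<omega> = n) * expectation (\<lambda>\<omega>. f (S n (Y \<omega>)))) sums expectation (\<lambda>\<omega>. f (S (T \<omega>) (Y \<omega>)))"
      if "indep_rv (count_space UNIV) T B Y" for T
      by (rule expectation_random_index[OF that, where v="\<lambda>n y. f (S n y)"]) (use bd in auto)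
    have "(\<lambda>n. q * (\<P>(\<omega> in M. N0 \<omega> = n) * expectation (\<lambda>\<omega>. f (S n (Y \<omega>))))) sums (q * expectation (\<lambda>\<omega>. f (W0 \<omega>)))"
      unfolding W0_def by (intro sums_mult * indep_N0)
    \<comment> \<open>The series for \<open>W0\<close> and \<open>W\<close> agree term by term: at
      \<open>n = 0\<close>, \<open>N0\<close> has no mass and E f(S 0) = f 0 = 0; elsewhere
      \<open>q\<close> times the mass of \<open>N0\<close> is that of \<open>N\<close>.\<close>
    moreover have "q * (\<P>(\<omega> in M. N0 \<omega> = n) * expectation (\<lambda>\<omega>. f (S n (Y \<omega>))))
        = \<P>(\<omega> in M. N \<omega> = n) * expectation (\<lambda>\<omega>. f (S n (Y \<omega>)))" for n
      by (cases "n = 0") (auto simp: mult.assoc[symmetric] N0_prob f0 S_def)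
    ultimately have "q * expectation (\<lambda>\<omega>. f (W0 \<omega>)) = expectation (\<lambda>\<omega>. f (W \<omega>))"
      using *[OF indep_N] unfolding W_eq by (simp add: sums_iff)
    moreover have int: "integrable M (\<lambda>\<omega>. f (Suc (W \<omega>)))" "integrable M (\<lambda>\<omega>. f (W0 \<omega>))"
      by (rule integrable_const_bound[of _ "1 / p"]; use bd in auto)+
    ultimately have "measure (law M W) A - measure_pmf.prob (geometric_pmf p) A
        = q * expectation (\<lambda>\<omega>. f (Suc (W \<omega>)) - f (W0 \<omega>))"
      unfolding eq by (simp add: right_diff_distrib)
    then have "ennreal \<bar>measure (law M W) A - measure_pmf.prob (geometric_pmf p) A\<bar>
        = ennreal q * ennreal (norm (expectation (\<lambda>\<omega>. f (Suc (W \<omega>)) - f (W0 \<omega>))))"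
      using q by (simp add: abs_mult ennreal_mult)
    \<comment> \<open>The bound moves to the extended nonnegative integral, since the block sum need
      not be integrable.\<close>
    also have "\<dots> \<le> ennreal q * (\<integral>\<^sup>+ \<omega>. ennreal (norm (f (Suc (W \<omega>)) - f (W0 \<omega>))) \<partial>M)"
      using int by (intro mult_left_mono integral_norm_bound_ennreal) auto
    also have "\<dots> \<le> ennreal q * (\<integral>\<^sup>+ \<omega>. ennreal \<bar>real (\<Sum>i=N \<omega> + 1..N0 \<omega>. X i \<omega>) - 1\<bar> \<partial>M)"
    proof (intro mult_left_mono nn_integral_mono_AE)
      show "AE \<omega> in M. ennreal (norm (f (Suc (W \<omega>)) - f (W0 \<omega>)))
          \<le> ennreal \<bar>real (\<Sum>i=N \<omega> + 1..N0 \<omega>. X i \<omega>) - 1\<bar>"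
        using N0_ge
      proof eventually_elim
        case (elim \<omega>)
        \<comment> \<open>As \<open>N \<le> N0\<close> here, \<open>W0\<close> extends
          \<open>W\<close> by the block of terms after \<open>N\<close>; the Lipschitz bound then
          compares this with \<open>W + 1\<close>.\<close>
        have "W0 \<omega> = W \<omega> + (\<Sum>i=N \<omega> + 1..N0 \<omega>. X i \<omega>)"
          using elim sum.ub_add_nat[of 1 "N \<omega>" "\<lambda>i. X i \<omega>" "N0 \<omega> - N \<omega>"]
          by (simp add: W0_def W_eq SY)
        then show ?case
          using lip[of "Suc (W \<omega>)" "W0 \<omega>"] by (intro ennreal_leI) (simp add: abs_minus_commute)
      qed
    qed simp
    finally show ?thesis .
  qed

  have first: "ennreal (tv_dist (law M W) (measure_pmf (geometric_pmf p)))
      \<le> ennreal q * (\<integral>\<^sup>+ \<omega>. ennreal \<bar>real (\<Sum>i=N \<omega> + 1..N0 \<omega>. X i \<omega>) - 1\<bar> \<partial>M)" (is "_ \<le> ?R")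
  proof (cases ?R rule: ennreal_cases)
    \<comment> \<open>A finite right side is a real bound valid for every set, hence for the
      supremum; an infinite one is trivial.\<close>
    case (real r)
    have "tv_dist (law M W) (measure_pmf (geometric_pmf p)) \<le> r"
      using part1 unfolding real(2) ennreal_le_iff[OF real(1)] by (rule tv_le)
    then show ?thesis unfolding real(2) by (rule ennreal_leI)
  next
    case top
    show ?thesis unfolding top by (rule top_greatest)
  qed

  \<comment> \<open>Common mean of the summands\<close>
  have EX: "integrable M (\<lambda>\<omega>. real (X i \<omega>)) \<and> expectation (\<lambda>\<omega>. real (X i \<omega>)) = \<mu>" if i: "1 \<le> i" for i
  proof -
    note [measurable] = X_meas[OF i] X_meas[of 1, simplified]
    have eq: "distr M (count_space UNIV) (X i) = distr M (count_space UNIV) (X 1)"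
      using X_ident[rule_format, OF i] unfolding law_def .
    have "integrable M (\<lambda>\<omega>. real (X i \<omega>)) = integrable M (\<lambda>\<omega>. real (X 1 \<omega>))"
      using integrable_distr_eq[of "X i" M "count_space UNIV" real] integrable_distr_eq[of "X 1" M "count_space UNIV" real] eq
      by simp
    moreover have "expectation (\<lambda>\<omega>. real (X i \<omega>)) = expectation (\<lambda>\<omega>. real (X 1 \<omega>))"
      using integral_distr[of "X i" M "count_space UNIV" real] integral_distr[of "X 1" M "count_space UNIV" real] eq
      by simp
    ultimately show ?thesis using X_integrable X_mean by simp
  qed

  \<comment> \<open>The second inequality, under the hazard condition\<close>
  have second: "ereal (tv_dist (law M W) (measure_pmf (geometric_pmf p)))
      \<le> ereal p * (ereal \<mu> * enn2ereal (\<integral>\<^sup>+ \<omega>. of_nat (N \<omega>) \<partial>M) + 1) - 1"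
    if cond: "\<forall>j. ennreal \<P>(\<omega> in M. N \<omega> = j) / ennreal \<P>(\<omega> in M. N \<omega> > j) \<le> ennreal (p / (1 - p))"
  proof (cases "(\<integral>\<^sup>+ \<omega>. of_nat (N \<omega>) \<partial>M) = \<top>")
    \<comment> \<open>With \<open>p > 0\<close> and \<open>\<mu> \<ge> 1\<close>, an infinite mean
      of \<open>N\<close> makes the right side infinite.\<close>
    case True
    then show ?thesis using p mu by (simp add: top_ennreal.rep_eq)
  next
    case False
    \<comment> \<open>Since \<open>q = 1 - p\<close>, splitting off the atom at \<open>k\<close>
      reduces this to \<open>q * ?a \<le> p * ?b\<close>, the hazard condition without
      denominators.\<close>
    have dom: "q * \<P>(\<omega> in M. k \<le> N \<omega>) \<le> \<P>(\<omega> in M. k < N \<omega>)" for k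
    proof -
      let ?a = "\<P>(\<omega> in M. N \<omega> = k)" and ?b = "\<P>(\<omega> in M. k < N \<omega>)"
      have "{\<omega>\<in>space M. k \<le> N \<omega>} = {\<omega>\<in>space M. N \<omega> = k} \<union> {\<omega>\<in>space M. k < N \<omega>}" by auto
      then have split: "\<P>(\<omega> in M. k \<le> N \<omega>) = ?a + ?b"
        by (simp add: finite_measure_Union disjoint_iff)
      have le: "ennreal ?a / ennreal ?b \<le> ennreal (p / q)"
        using cond q_def by simp
      have "q * ?a \<le> p * ?b"
      proof (cases "?b = 0")
        \<comment> \<open>In \<open>ennreal\<close>, x / 0 is \<top> for x \<noteq> 0 and 0 / 0 is
          0, so a finite bound on the ratio forces the atom at \<open>k\<close> to vanish together
          with the tail.\<close>
        case True
        then have "?a = 0"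
          using le by (cases "?a = 0") (auto simp: ennreal_divide_zero top_unique divide_ennreal_def)
        then show ?thesis using True by simp
      next
        case False
        then have "0 < ?b" by (simp add: zero_less_measure_iff)
        then show ?thesis using le p(2) q(1) by (simp add: divide_ennreal field_simps)
      qed
      then show ?thesis using q(3) by (simp add: split algebra_simps)
    qed
    have N_nn: "(\<integral>\<^sup>+ \<omega>. of_nat (N \<omega>) \<partial>M) = (\<integral>\<^sup>+ \<omega>. ennreal (real (N \<omega>)) \<partial>M)"
      by (simp add: ennreal_of_nat_eq_real_of_nat)
    have N_int: "integrable M (\<lambda>\<omega>. real (N \<omega>))"
      using False unfolding N_nn by (intro integrableI_bounded) (auto simp: less_top)
    define m where "m = expectation (\<lambda>\<omega>. real (N \<omega>))"
    have N_eq: "(\<integral>\<^sup>+ \<omega>. of_nat (N \<omega>) \<partial>M) = ennreal m" "0 \<le> m"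
      unfolding N_nn m_def by (auto intro: nn_integral_eq_integral N_int)
    have "\<bar>measure (law M W) A - measure_pmf.prob (geometric_pmf p) A\<bar> \<le> p * (\<mu> * m + 1) - 1" for A
    proof -
      obtain f :: "nat \<Rightarrow> real" where f0: "f 0 = 0" and lip: "\<And>j k. \<bar>f j - f k\<bar> \<le> \<bar>real j - real k\<bar>"
        and bd: "\<And>k. \<bar>f k\<bar> \<le> 1 / p"
        and eq: "measure (law M W) A - measure_pmf.prob (geometric_pmf p) A
          = q * expectation (\<lambda>\<omega>. f (Suc (W \<omega>))) - expectation (\<lambda>\<omega>. f (W \<omega>))"
        using stein[of A] by metis
      \<comment> \<open>Averaging over the sequence leaves functions of the index alone:
        \<open>g\<close> stands for \<open>f\<close> at \<open>W\<close>, \<open>g'\<close> for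
        \<open>f\<close> at \<open>W + 1\<close>.\<close>
      define g where "g n = expectation (\<lambda>\<omega>. f (S n (Y \<omega>)))" for n
      define g' where "g' n = expectation (\<lambda>\<omega>. f (Suc (S n (Y \<omega>))))" for n
      have f_int: "integrable M (\<lambda>\<omega>. f (h (S n (Y \<omega>))))" for h :: "nat \<Rightarrow> nat" and n
        by (rule integrable_const_bound[of _ "1 / p"]) (use bd in auto)
      have f_exp: "\<bar>expectation (\<lambda>\<omega>. f (h (S n (Y \<omega>))))\<bar> \<le> 1 / p" for h :: "nat \<Rightarrow> nat" and n
      proof -
        have "\<bar>expectation (\<lambda>\<omega>. f (h (S n (Y \<omega>))))\<bar> \<le> expectation (\<lambda>\<omega>. \<bar>f (h (S n (Y \<omega>)))\<bar>)"
          by (rule integral_abs_bound)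
        also have "\<dots> \<le> expectation (\<lambda>\<omega>. 1 / p)"
          using f_int[of h n] bd by (intro integral_mono) auto
        finally show ?thesis by (simp add: prob_space)
      qed
      have int: "integrable M (\<lambda>\<omega>. G (N \<omega>))" if "\<And>n. \<bar>G n\<bar> \<le> 1 / p" for G :: "nat \<Rightarrow> real"
        by (rule integrable_const_bound[of _ "1 / p"]) (use that in auto)
      have condition_N: "expectation (\<lambda>\<omega>. f (h (W \<omega>))) = expectation (\<lambda>\<omega>. expectation (\<lambda>\<omega>'. f (h (S (N \<omega>) (Y \<omega>')))))"
        for h :: "nat \<Rightarrow> nat"
      proof -
        have "(\<lambda>n. \<P>(\<omega> in M. N \<omega> = n) * expectation (\<lambda>\<omega>. f (h (S n (Y \<omega>))))) sums expectation (\<lambda>\<omega>. f (h (W \<omega>)))"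
          unfolding W_eq by (rule expectation_random_index[OF indep_N, where v="\<lambda>n y. f (h (S n y))"]) (use bd in auto)
        \<comment> \<open>The iterated expectation is expanded by the same lemma, with a
          \<open>v\<close> that is constant in the sequence, and gives the same series.\<close>
        moreover have "(\<lambda>n. \<P>(\<omega> in M. N \<omega> = n) * expectation (\<lambda>\<omega>. f (h (S n (Y \<omega>)))))
            sums expectation (\<lambda>\<omega>. expectation (\<lambda>\<omega>'. f (h (S (N \<omega>) (Y \<omega>')))))"
          using expectation_random_index[OF indep_N, where v="\<lambda>n _. expectation (\<lambda>\<omega>'. f (h (S n (Y \<omega>'))))" and C="1 / p"]
            f_exp[of h] by (simp add: prob_space)
        ultimately show ?thesis by (rule sums_unique2)
      qed
      have fW: "expectation (\<lambda>\<omega>. f (W \<omega>)) = expectation (\<lambda>\<omega>. g (N \<omega>))"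
        using condition_N[of "\<lambda>k. k"] by (simp add: g_def)
      have fSW: "expectation (\<lambda>\<omega>. f (Suc (W \<omega>))) = expectation (\<lambda>\<omega>. g' (N \<omega>))"
        using condition_N[of Suc] by (simp add: g'_def)
      have g_bd: "\<bar>g n\<bar> \<le> 1 / p" "\<bar>g' n\<bar> \<le> 1 / p" for n
        using f_exp[of "\<lambda>k. k" n] f_exp[of Suc n] by (auto simp: g_def g'_def)
      have gi: "integrable M (\<lambda>\<omega>. g (N \<omega>))" "integrable M (\<lambda>\<omega>. g (Suc (N \<omega>)))" "integrable M (\<lambda>\<omega>. g' (N \<omega>))"
        using g_bd by (auto intro: int[of g] int[of "\<lambda>n. g (Suc n)"] int[of g'])
      have g0: "g 0 = 0" by (simp add: g_def S_def f0)
      \<comment> \<open>Adding one summand moves the argument of \<open>f\<close> by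
        \<open>X (Suc n)\<close>, whose mean is \<mu>.\<close>
      have g_step: "\<bar>g (Suc n) - g n\<bar> \<le> \<mu>" for n
      proof -
        have "g (Suc n) - g n = expectation (\<lambda>\<omega>. f (S (Suc n) (Y \<omega>)) - f (S n (Y \<omega>)))"
          unfolding g_def using f_int[of "\<lambda>k. k"] by simp
        also have "\<bar>\<dots>\<bar> \<le> expectation (\<lambda>\<omega>. \<bar>f (S (Suc n) (Y \<omega>)) - f (S n (Y \<omega>))\<bar>)"
          by (rule integral_abs_bound)
        also have "\<dots> \<le> expectation (\<lambda>\<omega>. real (X (Suc n) \<omega>))"
        proof (rule integral_mono)
          show "\<bar>f (S (Suc n) (Y \<omega>)) - f (S n (Y \<omega>))\<bar> \<le> real (X (Suc n) \<omega>)" for \<omega>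
            using lip[of "S (Suc n) (Y \<omega>)" "S n (Y \<omega>)"] by (simp add: S_Suc)
        qed (use f_int[of "\<lambda>k. k"] EX[of "Suc n"] in auto)
        finally show ?thesis using EX[of "Suc n"] by simp
      qed
      \<comment> \<open>The two arguments of \<open>f\<close> differ by
        \<open>X (Suc n) - 1\<close>, which is nonnegative almost surely because the summands are
        positive.\<close>
      have g'_step: "\<bar>g' n - g (Suc n)\<bar> \<le> \<mu> - 1" for n
      proof -
        have "g' n - g (Suc n) = expectation (\<lambda>\<omega>. f (Suc (S n (Y \<omega>))) - f (S (Suc n) (Y \<omega>)))"
          unfolding g_def g'_def using f_int[of "\<lambda>k. k"] f_int[of Suc] by simp
        also have "\<bar>\<dots>\<bar> \<le> expectation (\<lambda>\<omega>. \<bar>f (Suc (S n (Y \<omega>))) - f (S (Suc n) (Y \<omega>))\<bar>)"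
          by (rule integral_abs_bound)
        also have "\<dots> \<le> expectation (\<lambda>\<omega>. real (X (Suc n) \<omega>) - 1)"
        proof (rule integral_mono_AE)
          show "AE \<omega> in M. \<bar>f (Suc (S n (Y \<omega>))) - f (S (Suc n) (Y \<omega>))\<bar> \<le> real (X (Suc n) \<omega>) - 1"
            using X_pos[rule_format, of "Suc n", simplified]
          proof eventually_elim
            case (elim \<omega>)
            then show ?case
              using lip[of "Suc (S n (Y \<omega>))" "S (Suc n) (Y \<omega>)"] by (simp add: S_Suc)
          qed
        qed (use f_int[of "\<lambda>k. k"] f_int[of Suc] EX[of "Suc n"] in auto)
        finally show ?thesis using EX[of "Suc n"] by (simp add: prob_space)
      qed
      \<comment> \<open>The sign \<open>s\<close> selects the upper or the lower bound on q E g(N +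
        1) - E g(N). The linear term outweighs the increments of \<open>g\<close>, so \<phi> is
        monotone for either sign.\<close>
      have lip_bound: "q * (\<mu> * (m + 1) + s * expectation (\<lambda>\<omega>. g (Suc (N \<omega>)))) \<le> \<mu> * m + s * expectation (\<lambda>\<omega>. g (N \<omega>))"
        if s: "s \<in> {-1, 1}" for s
      proof -
        define \<phi> where "\<phi> n = \<mu> * real n + s * g n" for n
        have "q * expectation (\<lambda>\<omega>. \<phi> (Suc (N \<omega>))) \<le> expectation (\<lambda>\<omega>. \<phi> (N \<omega>))"
        proof (rule expectation_Suc_le_of_tail_dominance)
          show "mono \<phi>"
          proof (rule incseq_SucI)
            show "\<phi> n \<le> \<phi> (Suc n)" for n
              using g_step[of n] s by (auto simp: \<phi>_def algebra_simps)
          qed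
          show "\<phi> 0 = 0" by (simp add: \<phi>_def g0)
          show "integrable M (\<lambda>\<omega>. \<phi> (N \<omega>))" "integrable M (\<lambda>\<omega>. \<phi> (Suc (N \<omega>)))"
            unfolding \<phi>_def using gi N_int by auto
        qed (use q dom in auto)
        moreover have "expectation (\<lambda>\<omega>. \<phi> (Suc (N \<omega>))) = \<mu> * (m + 1) + s * expectation (\<lambda>\<omega>. g (Suc (N \<omega>)))"
          unfolding \<phi>_def using gi N_int by (simp add: prob_space m_def distrib_left)
        moreover have "expectation (\<lambda>\<omega>. \<phi> (N \<omega>)) = \<mu> * m + s * expectation (\<lambda>\<omega>. g (N \<omega>))"
          unfolding \<phi>_def using gi N_int by (simp add: m_def)
        ultimately show ?thesis by simp
      qed
      have "\<bar>q * expectation (\<lambda>\<omega>. g (Suc (N \<omega>))) - expectation (\<lambda>\<omega>. g (N \<omega>))\<bar> \<le> \<mu> * m - q * (\<mu> * (m + 1))"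
        using lip_bound[of 1] lip_bound[of "-1"] by (auto simp: algebra_simps abs_le_iff)
      moreover have "\<bar>expectation (\<lambda>\<omega>. g' (N \<omega>)) - expectation (\<lambda>\<omega>. g (Suc (N \<omega>)))\<bar> \<le> \<mu> - 1"
      proof -
        have "\<bar>expectation (\<lambda>\<omega>. g' (N \<omega>)) - expectation (\<lambda>\<omega>. g (Suc (N \<omega>)))\<bar>
            = \<bar>expectation (\<lambda>\<omega>. g' (N \<omega>) - g (Suc (N \<omega>)))\<bar>"
          using gi by simp
        also have "\<dots> \<le> expectation (\<lambda>\<omega>. \<bar>g' (N \<omega>) - g (Suc (N \<omega>))\<bar>)"
          by (rule integral_abs_bound)
        also have "\<dots> \<le> expectation (\<lambda>\<omega>. \<mu> - 1)"
          using gi g'_step by (intro integral_mono) auto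
        finally show ?thesis by (simp add: prob_space)
      qed
      then have "\<bar>q * expectation (\<lambda>\<omega>. g' (N \<omega>)) - q * expectation (\<lambda>\<omega>. g (Suc (N \<omega>)))\<bar> \<le> q * (\<mu> - 1)"
        unfolding right_diff_distrib[symmetric] abs_mult using q by simp
      \<comment> \<open>Tail dominance contributes \<open>\<mu> * m - q * (\<mu> * (m + 1))\<close>
        and replacing the added 1 by a summand contributes \<open>q * (\<mu> - 1)\<close>; the terms
        \<open>q * \<mu>\<close> cancel.\<close>
      moreover have "\<mu> * m - q * (\<mu> * (m + 1)) + q * (\<mu> - 1) = p * (\<mu> * m + 1) - 1"
        by (simp add: q(3) algebra_simps)
      ultimately show ?thesis unfolding eq fW fSW by linarith
    qed
    then show ?thesis
      using tv_le[of "p * (\<mu> * m + 1) - 1"] N_eq(2)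
      by (simp add: N_eq(1) enn2ereal_ennreal one_ereal_def)
  qed
  show ?thesis using first second unfolding q_def by blast
qed

end
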